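(* For every positive integer $n$, every outerplanar graph that contains every outerplanar graph on $n$ vertices as a subgraph has at least $\sqrt{2}^{\,n-5}$ vertices.
   Context: Contained as a subgraph means there is an injective map of vertices sending edges to edges. *)

theory Defs
  imports "HOL-Analysis.Analysis"
begin

text \<open>A graph is given by its vertex set and its set of edges, each edge being a set of two
  vertices; graphs are finite and simple.\<close>

definition simple_graph :: "'a set \<Rightarrow> 'a set set \<Rightarrow> bool" where
  "simple_graph V E \<longleftrightarrow> finite V \<and> (\<forall>e\<in>E. e \<subseteq> V \<and> card e = 2)"

definition contained_as_subgraph ::
    "'b set \<Rightarrow> 'b set set \<Rightarrow> 'a set \<Rightarrow> 'a set set \<Rightarrow> bool" where
  "contained_as_subgraph W F V E \<longleftrightarrow>
     (\<exists>h. inj_on h W \<and> h ` W \<subseteq> V \<and> (\<forall>e\<in>F. h ` e \<in> E))"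

text \<open>Crossing-free drawings in the plane \<^typ>\<open>complex\<close>: vertices are distinct points, edges are
  arbitrary (topological) arcs, and two edges meet only in the images of common endpoints.\<close>

definition plane_drawing ::
    "'a set \<Rightarrow> 'a set set \<Rightarrow> ('a \<Rightarrow> complex) \<Rightarrow> ('a set \<Rightarrow> real \<Rightarrow> complex) \<Rightarrow> bool" where
  "plane_drawing V E p \<gamma> \<longleftrightarrow>
     inj_on p V \<and>
     (\<forall>e\<in>E. arc (\<gamma> e) \<and> {pathstart (\<gamma> e), pathfinish (\<gamma> e)} = p ` e \<and>
             path_image (\<gamma> e) \<inter> p ` V = p ` e) \<and>
     (\<forall>e\<in>E. \<forall>e'\<in>E. e \<noteq> e' \<longrightarrow> path_image (\<gamma> e) \<inter> path_image (\<gamma> e') = p ` (e \<inter> e'))"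

definition drawing_image ::
    "'a set \<Rightarrow> 'a set set \<Rightarrow> ('a \<Rightarrow> complex) \<Rightarrow> ('a set \<Rightarrow> real \<Rightarrow> complex) \<Rightarrow> complex set" where
  "drawing_image V E p \<gamma> = p ` V \<union> (\<Union>e\<in>E. path_image (\<gamma> e))"

text \<open>The drawing of a finite graph is compact, so \<^const>\<open>outside\<close> yields exactly its unbounded
  (outer) face; every vertex must lie on the boundary of that face.\<close>

definition outerplanar :: "'a set \<Rightarrow> 'a set set \<Rightarrow> bool" where
  "outerplanar V E \<longleftrightarrow>
     (\<exists>p \<gamma>. plane_drawing V E p \<gamma> \<and> p ` V \<subseteq> frontier (outside (drawing_image V E p \<gamma>)))"

end

theory Submission imports Defs begin

text \<open>Triangulated polygons whose dual tree is a path (strips) are outerplanar, and there are \<open>2 ^ (n - 5)\<close>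
  of them on \<open>n\<close> vertices when one of the two ends is distinguished.  Suppose that a strip is embedded
  in an outerplanar graph \<open>G\<close>, with the degree-two vertices at its ends mapped to \<open>u\<close> and \<open>v\<close>.  Every
  interior edge of the strip separates \<open>u\<close> from \<open>v\<close> in \<open>G\<close>: a path around it would yield a subdivision
  of \<open>K\<^sub>4\<close> whose four branch vertices lie on the outer face, which the Jordan curve theorem forbids.
  Conversely, a pair of vertices separating \<open>u\<close> from \<open>v\<close> in \<open>G\<close> also does so in the strip and is
  therefore one of its interior edges.  Hence the interior edges, and, by inclusion of the
  components of \<open>u\<close>, also their order, depend only on \<open>(u, v)\<close>.  So distinct strips have distinct
  pairs of ends, and \<open>2 ^ (n - 5) \<le> (card V)\<^sup>2\<close>.\<close>

section \<open>Crossing arcs in the plane\<close>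

text \<open>If \<open>z\<close> were inside \<open>K\<close>, the open set \<open>inside K\<close>
  would be a neighbourhood of \<open>z\<close> and so meet \<open>outside D\<close>, which lies in
  \<open>outside K\<close>. Vertices on the outer face are thus outside every part of the drawing
  that avoids them.\<close>

lemma frontier_outside_imp_outside:
  fixes z :: complex
  assumes "z \<in> frontier (outside D)" "K \<subseteq> D" "closed K" "z \<notin> K"
  shows "z \<in> outside K"
proof (rule ccontr)
  assume "z \<notin> outside K"
  with \<open>z \<notin> K\<close> have "z \<in> inside K"
    using inside_Un_outside[of K] by blast
  moreover have "z \<in> closure (outside D)"
    using assms(1) by (simp add: frontier_def)
  ultimately have "inside K \<inter> outside D \<noteq> {}"
    using open_Int_closure_eq_empty[OF open_inside[OF \<open>closed K\<close>]] by blast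
  then show False
    using outside_mono[OF \<open>K \<subseteq> D\<close>] inside_Int_outside[of K] by blast
qed

text \<open>If \<open>Q\<close> missed the inside \<open>U\<close> of \<open>A \<union> B\<close>, then \<open>U\<close> would lie outside both \<open>A \<union> Q\<close> and
  \<open>B \<union> Q\<close>, hence, by Janiszewski's theorem, outside \<open>A \<union> B \<union> Q\<close>.\<close>

lemma theta_meets_inside:
  fixes A B Q :: "complex set"
  assumes j: "simple_path j" "pathfinish j = pathstart j" "path_image j = A \<union> B"
    and cpt: "compact A" "compact B" "compact Q"
    and conn: "connected ((A \<union> Q) \<inter> (B \<union> Q))"
    and x: "x \<in> A" "x \<in> outside (B \<union> Q)"
    and y: "y \<in> B" "y \<in> outside (A \<union> Q)"
  shows "Q \<inter> inside (A \<union> B) \<noteq> {}"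
proof
  assume empty: "Q \<inter> inside (A \<union> B) = {}"
  define U where "U = inside (A \<union> B)"
  have U: "U \<noteq> {}" "connected U" "frontier U = A \<union> B"
    using Jordan_inside_outside[OF j(1,2)] unfolding j(3) U_def by blast+
  have disj: "U \<inter> (A \<union> B \<union> Q) = {}"
    using empty inside_no_overlap[of "A \<union> B"] unfolding U_def by blast
  \<comment> \<open>\<open>U\<close> is connected and misses \<open>S\<close>; its boundary point
    \<open>z\<close> lies in the open set \<open>outside S\<close>, so all of \<open>U\<close>
    does.\<close>
  have sub: "U \<subseteq> outside S"
    if S: "S \<subseteq> A \<union> B \<union> Q" "compact S" and z: "z \<in> A \<union> B" "z \<in> outside S" for S z
  proof -
    have "z \<in> closure U"
      using z(1) U(3) by (auto simp: frontier_def)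
    then have "outside S \<inter> U \<noteq> {}"
      using z(2) open_Int_closure_eq_empty[OF open_outside[OF compact_imp_closed[OF S(2)]]]
      by blast
    moreover have "S \<inter> U = {}"
      using disj S(1) by blast
    ultimately have "inside S \<inter> U = {}"
      using inside_outside_intersect_connected[OF U(2)] by blast
    then show ?thesis
      using \<open>S \<inter> U = {}\<close> inside_Un_outside[of S] by blast
  qed
  obtain w where w: "w \<in> U" using U(1) by blast
  have "outside (A \<union> B \<union> Q) \<noteq> {}"
    using cpt by (intro outside_bounded_nonempty) (simp add: compact_imp_bounded)
  then obtain z where z: "z \<in> outside (A \<union> B \<union> Q)" by blast
  have cc: "connected_component (- S) w z"
    if S: "S \<subseteq> A \<union> B \<union> Q" "compact S" and w: "w \<in> outside S" for S
  proof -
    have "connected (outside S)"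
      using S(2) by (intro connected_outside) (simp_all add: compact_imp_bounded)
    moreover have "z \<in> outside S"
      using z outside_mono[OF S(1)] by blast
    ultimately show ?thesis
      using w outside_no_overlap[of S] unfolding connected_component_def by blast
  qed
  have "connected_component (- (A \<union> Q)) w z"
    using w sub[of "A \<union> Q" y] y cpt by (intro cc) (auto simp: compact_Un)
  moreover have "connected_component (- (B \<union> Q)) w z"
    using w sub[of "B \<union> Q" x] x cpt by (intro cc) (auto simp: compact_Un)
  ultimately have "connected_component (- ((A \<union> Q) \<union> (B \<union> Q))) w z"
    using cpt conn
    by (intro Janiszewski[of "A \<union> Q" "B \<union> Q"]) (simp_all add: compact_Un compact_imp_closed closed_Un)
  then have "connected_component (- (A \<union> B)) z w"
    by (meson Compl_anti_mono connected_component_of_subset connected_component_sym sup_mono Un_upper1)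
  moreover have "z \<in> outside (A \<union> B)"
    using z outside_mono[of "A \<union> B" "A \<union> B \<union> Q"] by blast
  ultimately have "w \<in> outside (A \<union> B)"
    by (rule outside_same_component)
  then show False
    using w inside_Int_outside[of "A \<union> B"] unfolding U_def by blast
qed

text \<open>Cutting \<open>g1\<close> at \<open>a\<close> and \<open>g2\<close> at \<open>b\<close>
  lets the closed curve be regrouped into a half around \<open>X\<close> and a half around
  \<open>Y\<close>.\<close>

lemma arc_split_at:
  assumes g: "arc g" and a: "a \<in> path_image g" "a \<noteq> pathstart g" "a \<noteq> pathfinish g"
  obtains A B where "compact A" "compact B" "A \<union> B = path_image g" "A \<inter> B = {a}"
    "pathstart g \<in> A - B" "pathfinish g \<in> B - A"
proof -
  obtain t where t: "0 \<le> t" "t \<le> 1" "a = g t"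
    using a(1) by (auto simp: path_image_def)
  have cont: "continuous_on {0..1} g" and inj: "inj_on g {0..1}"
    using g by (auto simp: arc_def path_def)
  have t01: "0 < t" "t < 1"
    using t a(2,3) by (auto simp: pathstart_def pathfinish_def order_less_le)
  have "continuous_on {0..t} g" "continuous_on {t..1} g"
    using cont t by (auto elim!: continuous_on_subset)
  moreover have "g ` {0..t} \<inter> g ` {t..1} = g ` ({0..t} \<inter> {t..1})"
    using t by (intro inj_on_image_Int[OF inj, symmetric]) auto
  moreover have "{0..t} \<inter> {t..1} = {t}"
    using t by auto
  moreover have "g 0 \<notin> g ` {t..1}" "g 1 \<notin> g ` {0..t}"
    using inj_on_image_mem_iff[OF inj] t01 by auto
  ultimately show thesis
    using t01 t(3)
    by (intro that[of "g ` {0..t}" "g ` {t..1}"])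
       (auto simp: pathstart_def pathfinish_def path_image_def image_Un[symmetric] ivl_disj_un
         intro!: compact_continuous_image)
qed

lemma arc_minus_start_connected:
  assumes "arc g"
  shows "connected (path_image g - {pathstart g})"
proof -
  have "continuous_on {0..1} g" and inj: "inj_on g {0..1}"
    using assms by (auto simp: arc_def path_def)
  moreover have "{0<..1} = {0..1} - {0::real}"
    by auto
  then have "path_image g - {pathstart g} = g ` {0<..1}"
    using inj_on_image_set_diff[OF inj, of "{0..1}" "{0}"]
    by (simp add: path_image_def pathstart_def)
  ultimately show ?thesis
    by (auto intro!: connected_continuous_image elim: continuous_on_subset)
qed

text \<open>Both \<open>c\<close> and \<open>P\<close> must run inside the closed curve formed by \<open>g1\<close> and \<open>g2\<close>; but \<open>c\<close> cuts the
  inside into two parts, and neither of them is incident to both \<open>a\<close> and \<open>b\<close>.\<close>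

lemma no_crossing_arcs:
  fixes g1 g2 c P :: "real \<Rightarrow> complex"
  assumes g1: "arc g1" "pathstart g1 = X" "pathfinish g1 = Y"
    and g2: "arc g2" "pathstart g2 = X" "pathfinish g2 = Y"
    and c: "arc c" "pathstart c = X" "pathfinish c = Y"
    and P: "arc P" "pathstart P = a" "pathfinish P = b"
    and g1g2: "path_image g1 \<inter> path_image g2 = {X, Y}"
    and g1c: "path_image g1 \<inter> path_image c = {X, Y}"
    and g2c: "path_image g2 \<inter> path_image c = {X, Y}"
    and a: "a \<in> path_image g1 - {X, Y}" and b: "b \<in> path_image g2 - {X, Y}"
    and PJ: "path_image P \<inter> (path_image g1 \<union> path_image g2) = {a, b}"
    and Pc: "path_image P \<inter> path_image c = {}"
    and D: "path_image g1 \<union> path_image g2 \<union> path_image c \<union> path_image P \<subseteq> D"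
    and out: "{a, b, X, Y} \<subseteq> frontier (outside D)"
  shows False
proof -
  let ?G1 = "path_image g1" and ?G2 = "path_image g2" and ?C = "path_image c" and ?Q = "path_image P"
  have cpt: "compact ?G1" "compact ?G2" "compact ?C" "compact ?Q"
    using g1 g2 c P by (auto simp: arc_imp_path)
  have "X \<noteq> Y" using g1 by (metis arc_distinct_ends)
  define j where "j = g1 +++ reversepath g2"
  have j: "simple_path j" "pathfinish j = pathstart j" "path_image j = ?G1 \<union> ?G2"
    using g1 g2 g1g2 unfolding j_def
    by (auto simp: path_image_join arc_reversepath intro!: simple_path_join_loop)
  have outI: "z \<in> outside K"
    if "z \<in> {a, b, X, Y}" "K \<subseteq> ?G1 \<union> ?G2 \<union> ?C \<union> ?Q" "compact K" "z \<notin> K" for z K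
    using frontier_outside_imp_outside[of z D K] that D out compact_imp_closed by blast
  \<comment> \<open>The halves are \<open>g1\<close> and \<open>g2\<close>, which after adding
    \<open>c\<close> meet exactly in \<open>c\<close>; the points on the outer face are
    \<open>a\<close> and \<open>b\<close>.\<close>
  have c_inside: "?C \<inter> inside (?G1 \<union> ?G2) \<noteq> {}"
  proof (rule theta_meets_inside[OF j])
    have "(?G1 \<union> ?C) \<inter> (?G2 \<union> ?C) = ?C"
      using g1g2 g1c by blast
    then show "connected ((?G1 \<union> ?C) \<inter> (?G2 \<union> ?C))"
      using c by (simp add: arc_imp_path connected_path_image)
    show "a \<in> ?G1" "b \<in> ?G2" using a b by auto
    show "a \<in> outside (?G2 \<union> ?C)"
      using a g1g2 g1c cpt by (intro outI) (auto simp: compact_Un)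
    show "b \<in> outside (?G1 \<union> ?C)"
      using b g1g2 g2c cpt by (intro outI) (auto simp: compact_Un)
  qed (use cpt in auto)
  obtain A1 B1 where 1: "compact A1" "compact B1" "A1 \<union> B1 = ?G1" "A1 \<inter> B1 = {a}" "X \<in> A1 - B1"
    "Y \<in> B1 - A1"
    using arc_split_at[OF g1(1), of a] a unfolding g1(2,3) by blast
  obtain A2 B2 where 2: "compact A2" "compact B2" "A2 \<union> B2 = ?G2" "A2 \<inter> B2 = {b}" "X \<in> A2 - B2"
    "Y \<in> B2 - A2"
    using arc_split_at[OF g2(1), of b] b unfolding g2(2,3) by blast
  \<comment> \<open>The same closed curve, recut at \<open>a\<close> and \<open>b\<close>: now
    \<open>X\<close> and \<open>Y\<close> are the points on the outer face, and \<open>P\<close>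
    takes the role of \<open>c\<close>.\<close>
  have eq: "(A1 \<union> A2) \<union> (B1 \<union> B2) = ?G1 \<union> ?G2"
    using 1(3) 2(3) by blast
  have "?Q \<inter> inside ((A1 \<union> A2) \<union> (B1 \<union> B2)) \<noteq> {}"
  proof (rule theta_meets_inside[of j])
    have "A1 \<inter> B2 \<subseteq> ?G1 \<inter> ?G2" "A2 \<inter> B1 \<subseteq> ?G1 \<inter> ?G2"
      using 1(3) 2(3) by blast+
    then have "A1 \<inter> B2 \<subseteq> {X, Y}" "A2 \<inter> B1 \<subseteq> {X, Y}"
      by (simp_all add: g1g2)
    then have "A1 \<inter> B2 = {}" "A2 \<inter> B1 = {}"
      using 1(5,6) 2(5,6) by blast+
    moreover have "a \<in> ?Q" "b \<in> ?Q" using P by auto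
    moreover have "(A1 \<union> A2 \<union> ?Q) \<inter> (B1 \<union> B2 \<union> ?Q) =
        (A1 \<inter> B1) \<union> (A1 \<inter> B2) \<union> (A2 \<inter> B1) \<union> (A2 \<inter> B2) \<union> ?Q"
      by blast
    ultimately have "(A1 \<union> A2 \<union> ?Q) \<inter> (B1 \<union> B2 \<union> ?Q) = ?Q"
      using 1(4) 2(4) by auto
    then show "connected ((A1 \<union> A2 \<union> ?Q) \<inter> (B1 \<union> B2 \<union> ?Q))"
      using P by (simp add: arc_imp_path connected_path_image)
    show "X \<in> A1 \<union> A2" "Y \<in> B1 \<union> B2" using 1 2 by auto
    have XY: "X \<notin> ?Q" "Y \<notin> ?Q" using Pc c
      by (metis disjoint_iff pathstart_in_path_image pathfinish_in_path_image)+
    show "X \<in> outside (B1 \<union> B2 \<union> ?Q)"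
      using 1 2 cpt XY by (intro outI) (auto simp: compact_Un)
    show "Y \<in> outside (A1 \<union> A2 \<union> ?Q)"
      using 1 2 cpt XY by (intro outI) (auto simp: compact_Un)
  qed (use j eq cpt 1 2 in \<open>auto simp: compact_Un\<close>)
  then obtain z where z: "z \<in> ?Q" "z \<in> inside (?G1 \<union> ?G2)"
    unfolding eq by blast
  have "z \<notin> ?G1 \<union> ?G2" using z(2) inside_no_overlap by blast
  then have zab: "z \<noteq> a" "z \<noteq> b" using a b by auto
  \<comment> \<open>Since \<open>c\<close> runs through the inside, it splits it into the insides of
    the curves \<open>g1\<close>, \<open>c\<close> and \<open>g2\<close>, \<open>c\<close>.\<close>
  have z_cases: "z \<in> inside (?G1 \<union> ?C) \<or> z \<in> inside (?G2 \<union> ?C)"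
  proof (rule split_inside_simple_closed_curve[of g1 X Y g2 c])
    assume "inside (?G1 \<union> ?C) \<union> inside (?G2 \<union> ?C) \<union> (?C - {X, Y}) = inside (?G1 \<union> ?G2)"
    moreover have "z \<notin> ?C" using z(1) Pc by blast
    ultimately show ?thesis using z(2) by blast
  qed (use g1 g2 c \<open>X \<noteq> Y\<close> g1g2 g1c g2c c_inside in \<open>simp_all add: arc_imp_simple_path\<close>)
  have ab: "a \<notin> ?G2" "b \<notin> ?G1" using a b g1g2 by blast+
  have "a \<noteq> b" using ab a by blast
  then have abQ: "a \<in> ?Q - {b}" "b \<in> ?Q - {a}"
    unfolding P(2)[symmetric] P(3)[symmetric]
    by (simp_all add: pathstart_in_path_image pathfinish_in_path_image)
  have "?Q \<inter> ?G1 \<subseteq> {a, b}" "?Q \<inter> ?G2 \<subseteq> {a, b}" using PJ by blast+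
  then have QG: "?Q \<inter> ?G1 \<subseteq> {a}" "?Q \<inter> ?G2 \<subseteq> {b}" using ab by blast+
  \<comment> \<open>Without its start \<open>a\<close>, the arc \<open>P\<close> misses
    \<open>g1\<close> and \<open>c\<close>, yet it joins \<open>z\<close> to \<open>b\<close>, which
    is outside that curve.\<close>
  have False if "z \<in> inside (?G1 \<union> ?C)"
  proof -
    have "b \<in> outside (?G1 \<union> ?C)"
      using b g1g2 g2c cpt by (intro outI) (auto simp: compact_Un)
    moreover have "connected (?Q - {a})"
      using arc_minus_start_connected[OF P(1)] P by simp
    moreover have "(?G1 \<union> ?C) \<inter> (?Q - {a}) = {}"
      using QG(1) Pc by blast
    ultimately show False
      using inside_outside_intersect_connected[of "?Q - {a}" "?G1 \<union> ?C"] that z(1) zab abQ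
      by blast
  qed
  moreover have False if "z \<in> inside (?G2 \<union> ?C)"
  proof -
    have "a \<in> outside (?G2 \<union> ?C)"
      using a g1g2 g1c cpt by (intro outI) (auto simp: compact_Un)
    moreover have "connected (?Q - {b})"
      using arc_minus_start_connected[OF arc_reversepath[OF P(1)]] P by simp
    moreover have "(?G2 \<union> ?C) \<inter> (?Q - {b}) = {}"
      using QG(2) Pc by blast
    ultimately show False
      using inside_outside_intersect_connected[of "?Q - {b}" "?G2 \<union> ?C"] that z(1) zab abQ
      by blast
  qed
  ultimately show False using z_cases by blast
qed

section \<open>Strips\<close>

text \<open>A strip is a triangulated polygon whose dual tree is a path.  Vertex \<open>Suc k\<close> is glued onto the edge
  \<open>{pivot T k, k}\<close>, and \<open>T\<close> records the turns: it tells which endpoint of that edge remains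
  on the active edge \<open>{pivot T (Suc k), Suc k}\<close>.  The value \<open>pivot T 0 = 0\<close> is junk, chosen so that
  \<open>{pivot T 0, 1}\<close> repeats the edge \<open>{0, 1}\<close>.\<close>

primrec pivot :: "nat set \<Rightarrow> nat \<Rightarrow> nat" where
  "pivot T 0 = 0"
| "pivot T (Suc k) = (if Suc k \<in> T then k else pivot T k)"

definition strip_edges :: "nat set \<Rightarrow> nat \<Rightarrow> nat set set" where
  "strip_edges T n = {{k, Suc k} |k. Suc k < n} \<union> {{pivot T k, Suc k} |k. Suc k < n}"

lemma pivot_le: "pivot T k \<le> k"
  by (induction k) auto

lemma pivot_less: "0 < k \<Longrightarrow> pivot T k < k"
  by (cases k) (auto simp: pivot_le less_Suc_eq_le)

lemma strip_edges_Suc: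
  "0 < n \<Longrightarrow> strip_edges T (Suc n) = strip_edges T n \<union> {{n - 1, n}, {pivot T (n - 1), n}}"
  unfolding strip_edges_def by (cases n) (auto simp: less_Suc_eq)

lemma strip_edges_E:
  assumes "e \<in> strip_edges T n"
  obtains i j where "i < j" "j < n" "e = {i, j}"
  using assms pivot_le[of T, THEN le_imp_less_Suc] unfolding strip_edges_def by blast

lemma simple_graph_strip: "simple_graph {..<n} (strip_edges T n)"
  unfolding simple_graph_def by (auto elim!: strip_edges_E)

section \<open>Drawing strips with vertices on a parabola\<close>

text \<open>Two chords of a parabola over the pairs \<open>X\<close> and \<open>Y\<close> do not cross iff \<open>free_of X Y\<close> or
  \<open>free_of Y X\<close>.\<close>

definition free_of :: "real set \<Rightarrow> real set \<Rightarrow> bool" where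
  "free_of X Y \<longleftrightarrow> (\<forall>x\<in>X. \<forall>x'\<in>X. \<forall>y\<in>Y. \<not> (x < y \<and> y < x'))"

definition parabola :: "real \<Rightarrow> complex" where
  "parabola x = Complex x (x\<^sup>2)"

lemma parabola_eq_iff [simp]: "parabola x = parabola y \<longleftrightarrow> x = y"
  by (auto simp: parabola_def)

text \<open>The height of a chord above the parabola is a product that vanishes only at the two
  ends, so chords can be compared through their parameters.\<close>

lemma in_parabola_chord:
  assumes "a < b" "z \<in> closed_segment (parabola a) (parabola b)"
  shows "a \<le> Re z" "Re z \<le> b" "Im z - (Re z)\<^sup>2 = (Re z - a) * (b - Re z)"
proof -
  obtain u where u: "0 \<le> u" "u \<le> 1" "z = (1 - u) *\<^sub>R parabola a + u *\<^sub>R parabola b"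
    using assms(2) by (auto simp: closed_segment_def)
  have Re: "Re z = a + u * (b - a)" and Im: "Im z = a\<^sup>2 + u * (b\<^sup>2 - a\<^sup>2)"
    unfolding u(3) by (simp_all add: parabola_def) (simp_all add: algebra_simps)
  have "0 \<le> u * (b - a)" "u * (b - a) \<le> 1 * (b - a)"
    using u assms by (auto intro!: mult_right_mono)
  then show "a \<le> Re z" "Re z \<le> b" by (auto simp: Re)
  show "Im z - (Re z)\<^sup>2 = (Re z - a) * (b - Re z)"
    unfolding Re Im by (simp add: power2_eq_square algebra_simps)
qed

text \<open>With neither \<open>c\<close> nor \<open>d\<close> strictly between \<open>a\<close> and
  \<open>b\<close>, the parameter intervals share at most an end, or the first lies in the second.
  In the nested case the factors of the two heights compare termwise, and equality at an interior
  point would force the chords to coincide.\<close>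

lemma parabola_chords_meet:
  assumes "a < b" "c < d" "free_of {a, b} {c, d}" "\<not> (a = c \<and> b = d)"
    and z: "z \<in> closed_segment (parabola a) (parabola b)"
      "z \<in> closed_segment (parabola c) (parabola d)"
  shows "z \<in> parabola ` ({a, b} \<inter> {c, d})"
proof -
  define x where "x = Re z"
  have ab: "a \<le> x" "x \<le> b" "Im z - x\<^sup>2 = (x - a) * (b - x)"
    and cd: "c \<le> x" "x \<le> d" "Im z - x\<^sup>2 = (x - c) * (d - x)"
    using in_parabola_chord[OF assms(1) z(1)] in_parabola_chord[OF assms(2) z(2)]
    by (auto simp: x_def)
  have eq: "(x - a) * (b - x) = (x - c) * (d - x)" using ab cd by simp
  have "c \<le> a \<or> b \<le> c" "d \<le> a \<or> b \<le> d"
    using assms(1-3) by (auto simp: free_of_def)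
  then have "x \<in> {a, b} \<inter> {c, d}"
  proof (elim disjE)
    assume le: "c \<le> a" "b \<le> d"
    consider "x = a" | "x = b" | "a < x" "x < b" using ab by linarith
    then show ?thesis
    proof cases
      case 3
      have "(x - a) * (b - x) \<le> (x - a) * (d - x)"
        using le 3 by (intro mult_left_mono) auto
      moreover have "(x - a) * (d - x) \<le> (x - c) * (d - x)"
        using le 3 by (intro mult_right_mono) auto
      ultimately have "(x - a) * (b - x) = (x - a) * (d - x)"
        "(x - a) * (d - x) = (x - c) * (d - x)"
        using eq by linarith+
      then show ?thesis using 3 le assms(4) by auto
    qed (use eq le assms(1,2) in auto)
  qed (use ab cd assms(1,2) in auto)
  moreover from this have "Im z = x\<^sup>2" using ab cd by auto
  then have "z = parabola x" by (simp add: parabola_def x_def complex_eq_iff)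
  ultimately show ?thesis by blast
qed

text \<open>The active edge always spans all parameters used so far, so the new vertex can be put just beyond
  the endpoint that is dropped.\<close>

lemma strip_parameters:
  "\<exists>t :: nat \<Rightarrow> real. inj_on t {..k} \<and>
     (\<forall>j\<le>k. t j \<in> closed_segment (t (pivot T k)) (t k)) \<and>
     (\<forall>e\<in>strip_edges T (Suc k). \<forall>e'\<in>strip_edges T (Suc k).
        free_of (t ` e) (t ` e') \<or> free_of (t ` e') (t ` e))"
proof (induction k)
  case 0
  show ?case by (auto simp: strip_edges_def intro!: exI[of _ real])
next
  case (Suc k)
  then obtain t :: "nat \<Rightarrow> real" where inj: "inj_on t {..k}"
    and seg: "\<And>j. j \<le> k \<Longrightarrow> t j \<in> closed_segment (t (pivot T k)) (t k)"
    and free: "\<And>e e'. e \<in> strip_edges T (Suc k) \<Longrightarrow> e' \<in> strip_edges T (Suc k) \<Longrightarrow>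
        free_of (t ` e) (t ` e') \<or> free_of (t ` e') (t ` e)"
    by blast
  define a where "a = t (pivot T (Suc k))"
  define d where "d = (if Suc k \<in> T then t (pivot T k) else t k)"
  define x where "x = (if a \<le> d then d + 1 else d - 1)"
  define t' where "t' = t(Suc k := x)"
  have ad: "{t (pivot T k), t k} = {a, d}" by (auto simp: a_def d_def)
  have seg': "t j \<in> closed_segment a d" if "j \<le> k" for j
    using seg[OF that] ad by (auto simp: doubleton_eq_iff closed_segment_commute)
  have t't: "t' j = t j" if "j \<le> k" for j using that by (simp add: t'_def)
  have t'x: "t' (Suc k) = x" by (simp add: t'_def)
  have out: "x \<notin> closed_segment a d" "d \<in> closed_segment a x"
    by (auto simp: x_def closed_segment_eq_real_ivl)
  have inj': "inj_on t' {..Suc k}"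
    using inj seg' out(1) unfolding inj_on_def by (auto simp: t'_def le_Suc_eq)
  have seg'': "t' j \<in> closed_segment (t' (pivot T (Suc k))) (t' (Suc k))" if "j \<le> Suc k" for j
  proof (cases "j = Suc k")
    case False
    then have "t' j \<in> closed_segment a d" using that seg' t't by simp
    moreover have "closed_segment a d \<subseteq> closed_segment a x"
      using out(2) by (simp add: subset_closed_segment)
    moreover have "t' (pivot T (Suc k)) = a"
      using pivot_less[of "Suc k" T] unfolding a_def by (intro t't) linarith
    ultimately show ?thesis by (auto simp: t'x)
  qed simp
  have old: "t' ` e = t ` e \<and> t ` e \<subseteq> closed_segment a d" if "e \<in> strip_edges T (Suc k)" for e
    using that seg' t't by (elim strip_edges_E) auto
  have new: "t' ` e \<in> {{a, x}, {d, x}}" if "e \<in> {{k, Suc k}, {pivot T k, Suc k}}" for e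
    using that t'x t't[of k] t't[of "pivot T k"] pivot_le[of T k] ad
    by (auto simp: doubleton_eq_iff)
  \<comment> \<open>All old parameters lie between \<open>a\<close> and \<open>d\<close>, so neither
    these two nor \<open>x\<close> is strictly between two of them.\<close>
  have free_new: "free_of Y {a, x}" "free_of Y {d, x}" if "Y \<subseteq> closed_segment a d" for Y
    using that unfolding free_of_def
    by (auto simp: closed_segment_eq_real_ivl x_def split: if_splits; force)+
  have "free_of (t' ` e) (t' ` e') \<or> free_of (t' ` e') (t' ` e)"
    if "e \<in> strip_edges T (Suc (Suc k))" "e' \<in> strip_edges T (Suc (Suc k))" for e e'
  proof -
    have cases: "e \<in> strip_edges T (Suc k) \<or> e \<in> {{k, Suc k}, {pivot T k, Suc k}}"
      "e' \<in> strip_edges T (Suc k) \<or> e' \<in> {{k, Suc k}, {pivot T k, Suc k}}"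
      using that by (auto simp: strip_edges_Suc[of "Suc k"])
    then show ?thesis
    proof (elim disjE)
      assume "e \<in> strip_edges T (Suc k)" "e' \<in> strip_edges T (Suc k)"
      then show ?thesis using free old by presburger
    next
      assume "e \<in> strip_edges T (Suc k)" "e' \<in> {{k, Suc k}, {pivot T k, Suc k}}"
      then show ?thesis using free_new[of "t ` e"] old[of e] new[of e'] by auto
    next
      assume "e' \<in> strip_edges T (Suc k)" "e \<in> {{k, Suc k}, {pivot T k, Suc k}}"
      then show ?thesis using free_new[of "t ` e'"] old[of e'] new[of e] by auto
    next
      assume "e' \<in> {{k, Suc k}, {pivot T k, Suc k}}" "e \<in> {{k, Suc k}, {pivot T k, Suc k}}"
      then have "t' ` e \<in> {{a, x}, {d, x}}" "t' ` e' \<in> {{a, x}, {d, x}}" using new by auto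
      moreover have "free_of {d, x} {a, x}" "free_of {d, x} {d, x}" "free_of {a, x} {a, x}"
        by (auto simp: free_of_def x_def)
      ultimately show ?thesis by auto
    qed
  qed
  then show ?case using inj' seg'' by blast
qed

text \<open>The defect in convexity of the square is \<open>u * v * (Re z - Re w)\<^sup>2\<close>.
  Convexity keeps all chords above the parabola and hence the region below it in the outer
  face.\<close>

lemma convex_parabola_epigraph: "convex {z. (Re z)\<^sup>2 \<le> Im z}"
proof (rule convexI)
  fix z w :: complex and u v :: real
  assume *: "z \<in> {z. (Re z)\<^sup>2 \<le> Im z}" "w \<in> {z. (Re z)\<^sup>2 \<le> Im z}" "0 \<le> u" "0 \<le> v" "u + v = 1"
  then have v: "v = 1 - u" by simp
  have "u * (Re z)\<^sup>2 + v * (Re w)\<^sup>2 - (u * Re z + v * Re w)\<^sup>2 = u * v * (Re z - Re w)\<^sup>2"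
    unfolding v by (simp add: power2_eq_square algebra_simps)
  moreover have "0 \<le> u * v * (Re z - Re w)\<^sup>2" using * by simp
  moreover have "u * (Re z)\<^sup>2 \<le> u * Im z" "v * (Re w)\<^sup>2 \<le> v * Im w"
    using * by (auto intro: mult_left_mono)
  ultimately show "u *\<^sub>R z + v *\<^sub>R w \<in> {z. (Re z)\<^sup>2 \<le> Im z}" by simp
qed

text \<open>Vertices are placed on the parabola and edges drawn as chords. The parameters from
  \<open>strip_parameters\<close> prevent crossings, and the outer face reaches every vertex from
  below.\<close>

lemma outerplanar_strip: "outerplanar {..<n} (strip_edges T n)"
proof (cases n)
  case 0
  then show ?thesis
    by (auto simp: outerplanar_def plane_drawing_def strip_edges_def)
next
  case (Suc k)
  obtain t :: "nat \<Rightarrow> real" where inj: "inj_on t {..<n}"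
    and free: "\<And>e e'. e \<in> strip_edges T n \<Longrightarrow> e' \<in> strip_edges T n \<Longrightarrow>
        free_of (t ` e) (t ` e') \<or> free_of (t ` e') (t ` e)"
    using strip_parameters[of k T] unfolding Suc lessThan_Suc_atMost by blast
  define p where "p v = parabola (t v)" for v
  \<comment> \<open>\<open>Min\<close> and \<open>Max\<close> pick out the two ends of an edge,
    which is given only as an unordered set.\<close>
  define \<gamma> where "\<gamma> e = linepath (p (Min e)) (p (Max e))" for e
  have edge: "\<exists>i j. t i < t j \<and> i < n \<and> j < n \<and> e = {i, j} \<and> path_image (\<gamma> e) = closed_segment (parabola (t i)) (parabola (t j))"
    if e: "e \<in> strip_edges T n" for e
  proof -
    from e obtain i j where ij: "i < j" "j < n" "e = {i, j}" by (rule strip_edges_E)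
    then have "t i \<noteq> t j" using inj by (auto simp: inj_on_def)
    then consider "t i < t j" | "t j < t i" by linarith
    then show ?thesis
    proof cases
      case 1
      then show ?thesis using ij by (intro exI[of _ i] exI[of _ j]) (auto simp: \<gamma>_def p_def)
    next
      case 2
      then show ?thesis using ij
        by (intro exI[of _ j] exI[of _ i]) (auto simp: \<gamma>_def p_def closed_segment_commute)
    qed
  qed
  have meet: "path_image (\<gamma> e) \<inter> path_image (\<gamma> e') \<subseteq> p ` (e \<inter> e')"
    if e: "e \<in> strip_edges T n" "e' \<in> strip_edges T n" "e \<noteq> e'"
      "free_of (t ` e) (t ` e')" for e e'
  proof
    fix z assume z: "z \<in> path_image (\<gamma> e) \<inter> path_image (\<gamma> e')"
    obtain i j where ij: "t i < t j" "i < n" "j < n" "e = {i, j}"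
      "path_image (\<gamma> e) = closed_segment (parabola (t i)) (parabola (t j))"
      using edge[OF e(1)] by blast
    obtain k l where kl: "t k < t l" "k < n" "l < n" "e' = {k, l}"
      "path_image (\<gamma> e') = closed_segment (parabola (t k)) (parabola (t l))"
      using edge[OF e(2)] by blast
    have "\<not> (t i = t k \<and> t j = t l)"
      using ij kl e(3) inj by (auto simp: inj_on_def)
    then have "z \<in> parabola ` ({t i, t j} \<inter> {t k, t l})"
      using z ij kl e(4) by (intro parabola_chords_meet) auto
    moreover have "{t i, t j} \<inter> {t k, t l} = t ` (e \<inter> e')"
      using inj_on_image_Int[OF inj, of e e'] ij kl by simp
    ultimately show "z \<in> p ` (e \<inter> e')" by (auto simp: p_def)
  qed
  have ends: "p ` e \<subseteq> path_image (\<gamma> e)" if "e \<in> strip_edges T n" for e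
    using edge[OF that] by (auto simp: p_def)
  have on_parabola: "path_image (\<gamma> e) \<inter> p ` {..<n} = p ` e" if e: "e \<in> strip_edges T n" for e
  proof -
    obtain i j where ij: "t i < t j" "i < n" "j < n" "e = {i, j}"
      "path_image (\<gamma> e) = closed_segment (parabola (t i)) (parabola (t j))"
      using edge[OF e] by blast
    \<comment> \<open>At a point of the parabola the height of the chord is zero, so the point is an
      end of the chord.\<close>
    have "p v \<in> p ` e" if "p v \<in> path_image (\<gamma> e)" for v
      using in_parabola_chord(3)[OF ij(1), of "p v"] that ij(4,5)
      by (auto simp: p_def parabola_def)
    then show ?thesis using ends[OF e] ij by auto
  qed
  have "plane_drawing {..<n} (strip_edges T n) p \<gamma>"
    unfolding plane_drawing_def
  proof (intro conjI ballI impI)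
    show "inj_on p {..<n}" using inj by (auto simp: inj_on_def p_def)
  next
    fix e assume e: "e \<in> strip_edges T n"
    then obtain i j where ij: "i < j" "j < n" "e = {i, j}" by (rule strip_edges_E)
    then have "p i \<noteq> p j" using inj by (auto simp: inj_on_def p_def)
    then show "arc (\<gamma> e)" "{pathstart (\<gamma> e), pathfinish (\<gamma> e)} = p ` e"
      using ij by (auto simp: \<gamma>_def)
    show "path_image (\<gamma> e) \<inter> p ` {..<n} = p ` e" by (rule on_parabola[OF e])
  next
    fix e e' assume e: "e \<in> strip_edges T n" "e' \<in> strip_edges T n" "e \<noteq> e'"
    then have "path_image (\<gamma> e) \<inter> path_image (\<gamma> e') \<subseteq> p ` (e \<inter> e')"
      using free[OF e(1,2)] meet[OF e] meet[OF e(2,1)] by (auto simp: Int_commute)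
    then show "path_image (\<gamma> e) \<inter> path_image (\<gamma> e') = p ` (e \<inter> e')"
      using ends e by blast
  qed
  moreover have "p ` {..<n} \<subseteq> frontier (outside (drawing_image {..<n} (strip_edges T n) p \<gamma>))"
  proof
    let ?D = "drawing_image {..<n} (strip_edges T n) p \<gamma>"
    let ?H = "{z. (Re z)\<^sup>2 \<le> Im z}"
    have par: "parabola x \<in> ?H" for x by (simp add: parabola_def)
    have "path_image (\<gamma> e) \<subseteq> ?H" for e
      unfolding \<gamma>_def p_def path_image_linepath
      by (intro closed_segment_subset par convex_parabola_epigraph)
    then have "?D \<subseteq> ?H"
      using par unfolding drawing_image_def p_def by blast
    then have below: "- ?H \<subseteq> outside ?D"
      by (intro outside_subset_convex convex_parabola_epigraph)
    fix z assume "z \<in> p ` {..<n}"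
    then obtain v where v: "v < n" "z = p v" by blast
    have "z \<in> ?D" using v by (auto simp: drawing_image_def)
    then have "z \<notin> interior (outside ?D)"
      using interior_subset outside_no_overlap[of ?D] by blast
    moreover have "z \<in> closure (outside ?D)"
      unfolding closure_approachable
    proof (intro allI impI)
      fix \<epsilon> :: real assume "\<epsilon> > 0"
      let ?y = "Complex (t v) ((t v)\<^sup>2 - \<epsilon> / 2)"
      have "?y \<in> outside ?D" using below \<open>\<epsilon> > 0\<close> by auto
      moreover have "dist ?y z < \<epsilon>"
        using \<open>\<epsilon> > 0\<close> by (simp add: v p_def parabola_def dist_complex_def complex_diff cmod_def)
      ultimately show "\<exists>y\<in>outside ?D. dist y z < \<epsilon>" by blast
    qed
    ultimately show "z \<in> frontier (outside ?D)" by (simp add: frontier_def)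
  qed
  ultimately show ?thesis unfolding outerplanar_def by blast
qed

section \<open>Walks in plane drawings\<close>

abbreviation walk :: "'a set set \<Rightarrow> 'a list \<Rightarrow> bool" where
  "walk E \<equiv> successively (\<lambda>a b. {a, b} \<in> E)"

fun walk_edges :: "'a list \<Rightarrow> 'a set set" where
  "walk_edges (x # y # xs) = insert {x, y} (walk_edges (y # xs))"
| "walk_edges _ = {}"

lemma walk_converse: "successively (\<lambda>a b. {b, a} \<in> E) xs \<longleftrightarrow> walk E xs"
  by (simp add: insert_commute)

lemma walk_edges_subset: "walk E xs \<Longrightarrow> walk_edges xs \<subseteq> E"
  by (induction xs rule: walk_edges.induct) auto

lemma walk_edges_verts: "e \<in> walk_edges xs \<Longrightarrow> e \<subseteq> set xs"
  by (induction xs rule: walk_edges.induct) auto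

lemma Union_walk_edges: "2 \<le> length xs \<Longrightarrow> \<Union>(walk_edges xs) = set xs"
proof (induction xs rule: walk_edges.induct)
  case (1 x y xs)
  then show ?case by (cases xs) auto
qed auto

text \<open>Ensures that the edge between the ends of a path gives an arc of its own; length 3
  excludes the path that is just this edge.\<close>

lemma ends_notin_walk_edges:
  assumes "distinct xs" "3 \<le> length xs"
  shows "{hd xs, last xs} \<notin> walk_edges xs"
proof -
  obtain x y ys where xs: "xs = x # y # ys" "ys \<noteq> []"
    using assms(2) by (cases xs; cases "tl xs"; cases "tl (tl xs)") auto
  have "last ys \<noteq> y" using assms(1) xs last_in_set by fastforce
  moreover have "x \<notin> e" if "e \<in> walk_edges (y # ys)" for e
    using walk_edges_verts[OF that] assms(1) xs by auto
  ultimately show ?thesis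
    using xs assms(1) by (auto simp: doubleton_eq_iff)
qed

definition walk_image :: "('a set \<Rightarrow> real \<Rightarrow> complex) \<Rightarrow> 'a list \<Rightarrow> complex set" where
  "walk_image \<gamma> xs = (\<Union>e\<in>walk_edges xs. path_image (\<gamma> e))"

lemma walk_image_vertices:
  assumes "plane_drawing V E p \<gamma>" "walk E xs" "2 \<le> length xs"
  shows "walk_image \<gamma> xs \<inter> p ` V = p ` set xs"
proof -
  have "path_image (\<gamma> e) \<inter> p ` V = p ` e" if "e \<in> walk_edges xs" for e
  proof -
    have "e \<in> E" using that walk_edges_subset[OF assms(2)] by blast
    then show ?thesis using assms(1) by (simp add: plane_drawing_def)
  qed
  then have "(\<Union>e\<in>walk_edges xs. path_image (\<gamma> e) \<inter> p ` V) = (\<Union>e\<in>walk_edges xs. p ` e)"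
    by (rule SUP_cong[OF refl])
  then have "walk_image \<gamma> xs \<inter> p ` V = p ` (\<Union>(walk_edges xs))"
    by (simp add: walk_image_def image_Union)
  then show ?thesis using Union_walk_edges[OF assms(3)] by simp
qed

lemma walk_image_Int:
  assumes pd: "plane_drawing V E p \<gamma>" and w: "walk E xs" "walk E ys"
    and len: "2 \<le> length xs" "2 \<le> length ys" and disj: "walk_edges xs \<inter> walk_edges ys = {}"
  shows "walk_image \<gamma> xs \<inter> walk_image \<gamma> ys = p ` (set xs \<inter> set ys)"
proof
  show "walk_image \<gamma> xs \<inter> walk_image \<gamma> ys \<subseteq> p ` (set xs \<inter> set ys)"
  proof
    fix z assume "z \<in> walk_image \<gamma> xs \<inter> walk_image \<gamma> ys"
    then obtain e f where ef: "e \<in> walk_edges xs" "f \<in> walk_edges ys"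
      and z: "z \<in> path_image (\<gamma> e) \<inter> path_image (\<gamma> f)"
      by (auto simp: walk_image_def)
    have "e \<in> E" "f \<in> E" "e \<noteq> f"
      using ef disj walk_edges_subset[OF w(1)] walk_edges_subset[OF w(2)] by auto
    then have "z \<in> p ` (e \<inter> f)"
      using pd z unfolding plane_drawing_def by blast
    then show "z \<in> p ` (set xs \<inter> set ys)"
      using walk_edges_verts ef by blast
  qed
next
  show "p ` (set xs \<inter> set ys) \<subseteq> walk_image \<gamma> xs \<inter> walk_image \<gamma> ys"
    using walk_image_vertices[OF pd w(1) len(1)] walk_image_vertices[OF pd w(2) len(2)] by blast
qed

text \<open>Distinctness keeps the first edge out of the rest of the walk, so its arc meets the rest
  only in \<open>p y\<close> and the two can be joined. An edge drawn in the opposite direction is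
  reversed.\<close>

lemma walk_arc:
  assumes pd: "plane_drawing V E p \<gamma>"
  shows "walk E xs \<Longrightarrow> distinct xs \<Longrightarrow> 2 \<le> length xs \<Longrightarrow>
    \<exists>g. arc g \<and> pathstart g = p (hd xs) \<and> pathfinish g = p (last xs) \<and> path_image g = walk_image \<gamma> xs"
proof (induction xs rule: walk_edges.induct)
  case (1 x y xs)
  have edge: "{x, y} \<in> E" using 1 by simp
  have "\<exists>g. arc g \<and> pathstart g = p x \<and> pathfinish g = p y \<and> path_image g = path_image (\<gamma> {x, y})"
  proof -
    have "arc (\<gamma> {x, y})" "{pathstart (\<gamma> {x, y}), pathfinish (\<gamma> {x, y})} = {p x, p y}"
      using pd edge unfolding plane_drawing_def by auto
    then show ?thesis
      by (auto simp: doubleton_eq_iff intro: exI[of _ "\<gamma> {x, y}"] exI[of _ "reversepath (\<gamma> {x, y})"] arc_reversepath)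
  qed
  then obtain g where g: "arc g" "pathstart g = p x" "pathfinish g = p y"
    "path_image g = path_image (\<gamma> {x, y})"
    by blast
  show ?case
  proof (cases "xs = []")
    case True
    then show ?thesis using g by (auto simp: walk_image_def)
  next
    case False
    then have len: "2 \<le> length (y # xs)" by (cases xs) auto
    obtain g' where g': "arc g'" "pathstart g' = p y" "pathfinish g' = p (last xs)"
      "path_image g' = walk_image \<gamma> (y # xs)"
      using 1 len False by auto
    have "{x, y} \<notin> walk_edges (y # xs)"
      using walk_edges_verts[of "{x, y}" "y # xs"] 1(3) by auto
    then have "walk_image \<gamma> [x, y] \<inter> walk_image \<gamma> (y # xs) = p ` (set [x, y] \<inter> set (y # xs))"
      using 1(2) len by (intro walk_image_Int[OF pd]) auto
    also have "set [x, y] \<inter> set (y # xs) = {y}" using 1(3) by auto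
    finally have "path_image g \<inter> path_image g' = {p y}"
      using g g' by (simp add: walk_image_def)
    then have "arc (g +++ g')" using g g' by (intro arc_join) auto
    moreover have "path_image (g +++ g') = walk_image \<gamma> (x # y # xs)"
      using g g' by (subst path_image_join) (auto simp: walk_image_def)
    ultimately show ?thesis using g g' False by (intro exI[of _ "g +++ g'"]) auto
  qed
qed auto

lemma walk_in_graph:
  assumes "simple_graph V E" "walk E xs" "2 \<le> length xs"
  shows "set xs \<subseteq> V"
  using Union_walk_edges[OF assms(3)] walk_edges_subset[OF assms(2)] assms(1)
  unfolding simple_graph_def by blast

lemma walk_edges_disjoint:
  assumes "simple_graph V E" "walk E xs" "set xs \<inter> set ys \<subseteq> {v}"
  shows "walk_edges xs \<inter> walk_edges ys = {}"
proof (rule ccontr)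
  assume "walk_edges xs \<inter> walk_edges ys \<noteq> {}"
  then obtain e where e: "e \<in> walk_edges xs" "e \<in> walk_edges ys" by blast
  then have "e \<subseteq> {v}" using assms(3) walk_edges_verts by blast
  moreover have "card e = 2"
    using assms(1) walk_edges_subset[OF assms(2)] e unfolding simple_graph_def by blast
  ultimately show False
    using card_mono[of "{v}" e] by auto
qed

text \<open>The three walks and the edge \<open>{x, y}\<close> form a subdivision of the complete
  graph on \<open>x\<close>, \<open>y\<close>, \<open>a\<close>, \<open>b\<close>. Drawn as arcs,
  they are \<open>g1\<close>, \<open>g2\<close>, \<open>P\<close> and \<open>c\<close> of
  \<open>no_crossing_arcs\<close>.\<close>

lemma outerplanar_no_crossing_walks:
  assumes G: "simple_graph V E" "outerplanar V E"
    and xs: "walk E xs" "distinct xs" "hd xs = x" "last xs = y" "a \<in> set xs - {x, y}"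
    and ys: "walk E ys" "distinct ys" "hd ys = x" "last ys = y" "b \<in> set ys - {x, y}"
    and xy: "{x, y} \<in> E"
    and zs: "walk E zs" "distinct zs" "zs \<noteq> []" "hd zs = a" "last zs = b"
    and xsys: "set xs \<inter> set ys = {x, y}"
    and zsxs: "set zs \<inter> set xs = {a}" and zsys: "set zs \<inter> set ys = {b}"
  shows False
proof -
  obtain p \<gamma> where pd: "plane_drawing V E p \<gamma>"
    and out: "p ` V \<subseteq> frontier (outside (drawing_image V E p \<gamma>))"
    using G(2) unfolding outerplanar_def by blast
  have "x \<noteq> y" using xy G(1) unfolding simple_graph_def by fastforce
  have three: "3 \<le> length us" if "x \<in> set us" "y \<in> set us" "c \<in> set us - {x, y}" for us c
  proof -
    have "card {x, y, c} \<le> card (set us)" using that by (intro card_mono) auto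
    then show ?thesis using that \<open>x \<noteq> y\<close> card_length[of us] by auto
  qed
  have ends: "x \<in> set xs" "y \<in> set xs" "x \<in> set ys" "y \<in> set ys"
    using xsys by auto
  have len: "3 \<le> length xs" "3 \<le> length ys"
    using three[OF ends(1,2) xs(5)] three[OF ends(3,4) ys(5)] by auto
  have "a \<noteq> b" using xs(5) ys(5) xsys by blast
  then have lenz: "2 \<le> length zs"
    using zs by (cases zs; cases "tl zs") auto
  let ?W = "walk_image \<gamma>"
  have w_xy: "walk E [x, y]" using xy by simp
  have ends_nin: "{x, y} \<notin> walk_edges xs" "{x, y} \<notin> walk_edges ys"
    using ends_notin_walk_edges[OF xs(2) len(1)] ends_notin_walk_edges[OF ys(2) len(2)] xs ys
    by auto
  have edge_V: "e \<subseteq> V \<and> card e = 2" if "e \<in> E" for e using G(1) that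
    by (auto simp: simple_graph_def)
  \<comment> \<open>A common edge could only be \<open>{x, y}\<close>, which neither walk
    uses.\<close>
  have xs_ys: "walk_edges xs \<inter> walk_edges ys = {}"
  proof (rule ccontr)
    assume "walk_edges xs \<inter> walk_edges ys \<noteq> {}"
    then obtain e where e: "e \<in> walk_edges xs" "e \<in> walk_edges ys" by blast
    then have "e \<subseteq> {x, y}" using xsys walk_edges_verts by blast
    moreover have "card e = 2" using edge_V walk_edges_subset[OF xs(1)] e by blast
    ultimately have "e = {x, y}" using \<open>x \<noteq> y\<close> by (intro card_subset_eq) auto
    then show False using e ends_nin by simp
  qed
  obtain g1 where g1: "arc g1" "pathstart g1 = p x" "pathfinish g1 = p y" "path_image g1 = ?W xs"
    using walk_arc[OF pd xs(1,2)] len xs by auto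
  obtain g2 where g2: "arc g2" "pathstart g2 = p x" "pathfinish g2 = p y" "path_image g2 = ?W ys"
    using walk_arc[OF pd ys(1,2)] len ys by auto
  obtain c where c: "arc c" "pathstart c = p x" "pathfinish c = p y" "path_image c = ?W [x, y]"
    using walk_arc[OF pd w_xy] \<open>x \<noteq> y\<close> by auto
  obtain P where P: "arc P" "pathstart P = p a" "pathfinish P = p b" "path_image P = ?W zs"
    using walk_arc[OF pd zs(1,2)] lenz zs by auto
  have verts: "set xs \<subseteq> V" "set ys \<subseteq> V" "set zs \<subseteq> V"
    using walk_in_graph[OF G(1) xs(1)] walk_in_graph[OF G(1) ys(1)] walk_in_graph[OF G(1) zs(1)] len lenz
    by linarith+
  have inj: "inj_on p V" using pd unfolding plane_drawing_def by blast
  have img: "p v \<in> ?W us \<longleftrightarrow> v \<in> set us" if "walk E us" "2 \<le> length us" "v \<in> V" for v us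
    using walk_image_vertices[OF pd that(1,2)] inj that(3) walk_in_graph[OF G(1) that(1,2)]
    by (metis IntD1 IntI image_eqI inj_on_image_mem_iff)
  have drawn: "?W us \<subseteq> drawing_image V E p \<gamma>" if "walk E us" for us
    using walk_edges_subset[OF that] unfolding walk_image_def drawing_image_def by blast
  have nxy: "x \<notin> set zs" "y \<notin> set zs"
    using xs(5) ends zsxs by auto
  show False
  proof (rule no_crossing_arcs[OF g1(1-3) g2(1-3) c(1-3) P(1-3)])
    show "path_image g1 \<inter> path_image g2 = {p x, p y}"
      using walk_image_Int[OF pd xs(1) ys(1) _ _ xs_ys] len xsys by (simp add: g1 g2)
    show "path_image g1 \<inter> path_image c = {p x, p y}"
      using walk_image_Int[OF pd xs(1) w_xy] len ends ends_nin by (simp add: g1 c)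
    show "path_image g2 \<inter> path_image c = {p x, p y}"
      using walk_image_Int[OF pd ys(1) w_xy] len ends ends_nin by (simp add: g2 c)
    have "?W zs \<inter> ?W xs = {p a}"
      using walk_image_Int[OF pd zs(1) xs(1)] walk_edges_disjoint[OF G(1) zs(1)] len lenz zsxs
      by simp
    moreover have "?W zs \<inter> ?W ys = {p b}"
      using walk_image_Int[OF pd zs(1) ys(1)] walk_edges_disjoint[OF G(1) zs(1)] len lenz zsys
      by simp
    ultimately show "path_image P \<inter> (path_image g1 \<union> path_image g2) = {p a, p b}"
      by (auto simp: g1 g2 P)
    have "set zs \<inter> set [x, y] = {}" using nxy by auto
    then show "path_image P \<inter> path_image c = {}"
      using walk_image_Int[OF pd zs(1) w_xy] walk_edges_disjoint[OF G(1) zs(1), of "[x, y]"] lenz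
      by (simp add: P c)
    show "p a \<in> path_image g1 - {p x, p y}"
      using img[OF xs(1)] len xs(5) verts ends inj by (auto simp: g1 inj_on_def subset_iff)
    show "p b \<in> path_image g2 - {p x, p y}"
      using img[OF ys(1)] len ys(5) verts ends inj by (auto simp: g2 inj_on_def subset_iff)
    show "path_image g1 \<union> path_image g2 \<union> path_image c \<union> path_image P \<subseteq> drawing_image V E p \<gamma>"
      using drawn[OF xs(1)] drawn[OF ys(1)] drawn[OF w_xy] drawn[OF zs(1)]
      by (simp add: g1 g2 c P)
    show "{p a, p b, p x, p y} \<subseteq> frontier (outside (drawing_image V E p \<gamma>))"
      using out xs(5) ys(5) ends verts by blast
  qed
qed

section \<open>Reachability avoiding a set of vertices\<close>

text \<open>The start \<open>u\<close> always belongs to \<open>reach E Z u\<close>, even if \<open>u \<in> Z\<close>.\<close>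

definition reach :: "'a set set \<Rightarrow> 'a set \<Rightarrow> 'a \<Rightarrow> 'a set" where
  "reach E Z u = {w. (\<lambda>a b. {a, b} \<in> E \<and> b \<notin> Z)\<^sup>*\<^sup>* u w}"

lemma reach_refl: "u \<in> reach E Z u"
  by (simp add: reach_def)

lemma reach_step: "a \<in> reach E Z u \<Longrightarrow> {a, b} \<in> E \<Longrightarrow> b \<notin> Z \<Longrightarrow> b \<in> reach E Z u"
  by (simp add: reach_def rtranclp.rtrancl_into_rtrancl)

lemma reach_induct [consumes 1, case_names refl step]:
  assumes "w \<in> reach E Z u" "P u"
    "\<And>a b. a \<in> reach E Z u \<Longrightarrow> {a, b} \<in> E \<Longrightarrow> b \<notin> Z \<Longrightarrow> P a \<Longrightarrow> P b"
  shows "P w"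
  using assms(1) unfolding reach_def mem_Collect_eq
  by (induction rule: rtranclp_induct) (use assms(2,3) in \<open>auto simp: reach_def\<close>)

lemma reach_avoids: "w \<in> reach E Z u \<Longrightarrow> u \<notin> Z \<Longrightarrow> w \<notin> Z"
  by (induction rule: reach_induct) auto

lemma reach_walk:
  assumes "w \<in> reach E Z u" "u \<notin> Z"
  shows "\<exists>zs. walk E zs \<and> zs \<noteq> [] \<and> hd zs = u \<and> last zs = w \<and> set zs \<inter> Z = {}"
  using assms(1)
proof (induction rule: reach_induct)
  case refl
  show ?case using assms(2) by (intro exI[of _ "[u]"]) auto
next
  case (step a b)
  then obtain zs where "walk E zs" "zs \<noteq> []" "hd zs = u" "last zs = a" "set zs \<inter> Z = {}" by blast
  then show ?case using step by (intro exI[of _ "zs @ [b]"]) (auto simp: successively_append_iff)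
qed

text \<open>A walk of least length from \<open>A\<close> to \<open>B\<close> avoiding
  \<open>Z\<close> serves: a repeated vertex would allow a loop to be cut out, a later vertex in
  \<open>A\<close> a shorter suffix, an earlier vertex in \<open>B\<close> a shorter prefix.\<close>

lemma shortest_crossing_walk:
  assumes "w \<in> reach E Z u" "u \<notin> Z" "u \<in> A" "w \<in> B"
  obtains zs where "walk E zs" "distinct zs" "zs \<noteq> []" "set zs \<inter> Z = {}"
    "hd zs \<in> A" "last zs \<in> B" "set zs \<inter> A = {hd zs}" "set zs \<inter> B = {last zs}"
proof -
  let ?P = "\<lambda>zs. walk E zs \<and> zs \<noteq> [] \<and> hd zs \<in> A \<and> last zs \<in> B \<and> set zs \<inter> Z = {}"
  obtain zs0 where "?P zs0" using reach_walk[OF assms(1,2)] assms(3,4) by metis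
  then obtain zs where zs: "?P zs" and least: "\<And>ys. ?P ys \<Longrightarrow> length zs \<le> length ys"
    using ex_has_least_nat[of ?P zs0 length] by blast
  have "distinct zs"
  proof (rule ccontr)
    assume "\<not> distinct zs"
    then obtain xs ys rs v where eq: "zs = xs @ [v] @ ys @ [v] @ rs"
      using not_distinct_decomp by blast
    have "walk E ((xs @ [v]) @ ys @ ([v] @ rs))" using zs by (simp add: eq)
    then have "walk E (xs @ [v])" "walk E ([v] @ rs)"
      by (simp_all only: successively_append_iff)
    then have "walk E (xs @ [v] @ rs)"
      by (auto simp: successively_append_iff)
    moreover have "hd (xs @ [v] @ rs) = hd zs" "last (xs @ [v] @ rs) = last zs"
      by (simp_all add: eq hd_append)
    ultimately have "?P (xs @ [v] @ rs)"
      using zs by (auto simp: eq)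
    from least[OF this] show False by (simp add: eq)
  qed
  moreover have "v = hd zs" if v: "v \<in> set zs" "v \<in> A" for v
  proof -
    obtain xs ys where eq: "zs = xs @ v # ys" using v(1) by (auto simp: in_set_conv_decomp)
    moreover have "walk E (v # ys)" using zs by (simp add: eq successively_append_iff)
    ultimately have "?P (v # ys)" using zs v by auto
    from least[OF this] show ?thesis by (simp add: eq)
  qed
  moreover have "v = last zs" if v: "v \<in> set zs" "v \<in> B" for v
  proof -
    obtain xs ys where eq: "zs = xs @ v # ys" using v(1) by (auto simp: in_set_conv_decomp)
    moreover have "walk E ((xs @ [v]) @ ys)" using zs by (simp add: eq)
    then have "walk E (xs @ [v])" by (simp only: successively_append_iff)
    moreover have "hd (xs @ [v]) = hd zs" by (simp add: eq hd_append)
    ultimately have "?P (xs @ [v])" using zs v by auto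
    from least[OF this] show ?thesis by (simp add: eq)
  qed
  ultimately show thesis using zs by (intro that[of zs]) auto
qed

section \<open>Embedded strips\<close>

lemma strip_edge_Suc: "Suc k < n \<Longrightarrow> {k, Suc k} \<in> strip_edges T n"
  and strip_edge_pivot_Suc: "Suc k < n \<Longrightarrow> {pivot T k, Suc k} \<in> strip_edges T n"
  by (auto simp: strip_edges_def)

lemma pivot_Suc_cases: "pivot T (Suc k) = k \<or> pivot T (Suc k) = pivot T k"
  by simp

declare pivot.simps(2) [simp del]

lemma strip_edge_pivot: "0 < k \<Longrightarrow> k < n \<Longrightarrow> {pivot T k, k} \<in> strip_edges T n"
  by (cases k) (auto simp: strip_edge_Suc strip_edge_pivot_Suc pivot.simps(2))

section \<open>Boundary paths on the two sides of an interior edge\<close>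

text \<open>For \<open>2 \<le> k\<close> this path is the boundary of the polygon on
  \<open>{..k}\<close> without its active edge. Vertex \<open>Suc k\<close> is attached to the end
  that is dropped, so the path is reversed first when the pivot changes to \<open>k\<close>.\<close>

lemma lower_boundary_walk:
  "0 < k \<Longrightarrow> k < n \<Longrightarrow> \<exists>xs. walk (strip_edges T n) xs \<and> distinct xs \<and> set xs = {..k} \<and>
     hd xs = pivot T k \<and> last xs = k"
proof (induction k)
  case (Suc k)
  show ?case
  proof (cases "k = 0")
    case True
    then show ?thesis
      using Suc.prems by (intro exI[of _ "[0, 1]"]) (auto simp: strip_edge_Suc pivot.simps(2))
  next
    case False
    then obtain xs where xs: "walk (strip_edges T n) xs" "distinct xs" "set xs = {..k}"
      "hd xs = pivot T k" "last xs = k"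
      using Suc by auto
    then have "xs \<noteq> []" by auto
    from pivot_Suc_cases[of T k] show ?thesis
    proof
      assume eq: "pivot T (Suc k) = k"
      have "walk (strip_edges T n) (rev xs @ [Suc k])"
        using xs Suc.prems strip_edge_pivot_Suc[of k n T]
        by (simp add: successively_append_iff walk_converse last_rev)
      moreover have "set (rev xs @ [Suc k]) = {..Suc k}" by (simp add: xs(3) atMost_Suc)
      ultimately show ?thesis
        using xs \<open>xs \<noteq> []\<close> eq by (intro exI[of _ "rev xs @ [Suc k]"]) (simp add: hd_append hd_rev)
    next
      assume eq: "pivot T (Suc k) = pivot T k"
      have "walk (strip_edges T n) (xs @ [Suc k])"
        using xs Suc.prems strip_edge_Suc[of k n T] by (simp add: successively_append_iff)
      moreover have "set (xs @ [Suc k]) = {..Suc k}" by (simp add: xs(3) atMost_Suc)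
      ultimately show ?thesis
        using xs \<open>xs \<noteq> []\<close> eq by (intro exI[of _ "xs @ [Suc k]"]) simp
    qed
  qed
qed simp

text \<open>Induction runs down from \<open>n - 1\<close>, where the path is a single edge. Each
  step attaches to \<open>Suc k\<close> the end of \<open>{pivot T k, k}\<close> that is not on the
  next active edge.\<close>

lemma upper_boundary_walk:
  assumes "0 < k" "k < n"
  shows "\<exists>xs. walk (strip_edges T n) xs \<and> distinct xs \<and> set xs = insert (pivot T k) {k..<n} \<and>
     hd xs = pivot T k \<and> last xs = k"
proof -
  have "k \<le> n - 1" using assms by simp
  then show ?thesis using assms(1)
  proof (induction k rule: inc_induct)
    case base
    then show ?case
      using strip_edge_pivot[of "n - 1" n T] pivot_less[of "n - 1" T]
      by (intro exI[of _ "[pivot T (n - 1), n - 1]"]) auto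
  next
    case (step k)
    then obtain xs where xs: "walk (strip_edges T n) xs" "distinct xs"
      "set xs = insert (pivot T (Suc k)) {Suc k..<n}"
      "hd xs = pivot T (Suc k)" "last xs = Suc k"
      by auto
    then have "xs \<noteq> []" by auto
    have less: "pivot T k < k" "Suc k < n" using step.hyps step.prems pivot_less[of k T]
      by linarith+
    have ivl: "{k..<n} = insert k {Suc k..<n}" using less(2) by fastforce
    from pivot_Suc_cases[of T k] show ?case
    proof
      assume eq: "pivot T (Suc k) = k"
      have "set (pivot T k # rev xs) = insert (pivot T k) {k..<n}"
        by (simp add: xs(3) eq ivl)
      moreover have "walk (strip_edges T n) (pivot T k # rev xs)"
        using xs \<open>xs \<noteq> []\<close> less strip_edge_pivot_Suc[of k n T]
        by (simp add: successively_Cons walk_converse hd_rev)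
      moreover have "distinct (pivot T k # rev xs)" using less by (simp add: xs(2,3) eq)
      ultimately show ?thesis
        using xs eq \<open>xs \<noteq> []\<close> by (intro exI[of _ "pivot T k # rev xs"]) (simp add: last_rev)
    next
      assume eq: "pivot T (Suc k) = pivot T k"
      have "set (xs @ [k]) = insert (pivot T k) {k..<n}"
        by (simp add: xs(3) eq ivl insert_commute)
      moreover have "walk (strip_edges T n) (xs @ [k])"
        using xs \<open>xs \<noteq> []\<close> less strip_edge_Suc[of k n T]
        by (simp add: successively_append_iff insert_commute)
      moreover have "distinct (xs @ [k])" using less by (simp add: xs(2,3) eq)
      ultimately show ?thesis
        using xs eq \<open>xs \<noteq> []\<close> by (intro exI[of _ "xs @ [k]"]) simp
    qed
  qed
qed

section \<open>Rungs of an embedded strip as separators\<close>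

locale embedded_strip =
  fixes E :: "'a set set" and n :: nat and T :: "nat set" and h :: "nat \<Rightarrow> 'a"
  assumes inj: "inj_on h {..<n}"
    and edges: "\<And>e. e \<in> strip_edges T n \<Longrightarrow> h ` e \<in> E"
    and two: "2 \<in> T"
begin

text \<open>The condition \<open>2 \<in> T\<close> says that vertex \<open>0\<close> has degree two, so that it lies on no rung \<open>k\<close> with
  \<open>2 \<le> k\<close>.\<close>

definition rung :: "nat \<Rightarrow> 'a set" where
  "rung k = h ` {pivot T k, k}"

lemma pivot_pos: "2 \<le> k \<Longrightarrow> 0 < pivot T k"
proof (induction k rule: dec_induct)
  case base
  then show ?case using two by (simp add: numeral_2_eq_2 pivot.simps(2))
next
  case (step k)
  then show ?case using pivot_Suc_cases[of T k] by auto
qed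

lemma h_in_image: "i < n \<Longrightarrow> S \<subseteq> {..<n} \<Longrightarrow> h i \<in> h ` S \<longleftrightarrow> i \<in> S"
  using inj_on_image_mem_iff[OF inj, of i S] by auto

lemma rung_sub: "k < n \<Longrightarrow> {pivot T k, k} \<subseteq> {..<n}"
  using pivot_le[of T k] by auto

lemma in_rung: "i < n \<Longrightarrow> k < n \<Longrightarrow> h i \<in> rung k \<longleftrightarrow> i \<in> {pivot T k, k}"
  unfolding rung_def by (intro h_in_image rung_sub)

lemma card_rung: "0 < k \<Longrightarrow> k < n \<Longrightarrow> card (rung k) = 2"
  using pivot_less[of k T] card_image[OF inj_on_subset[OF inj rung_sub[of k]]] unfolding rung_def
  by simp

lemma edge_Suc: "Suc k < n \<Longrightarrow> {h k, h (Suc k)} \<in> E"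
  and edge_pivot_Suc: "Suc k < n \<Longrightarrow> {h (pivot T k), h (Suc k)} \<in> E"
  using edges strip_edge_Suc[of k n T] strip_edge_pivot_Suc[of k n T] by fastforce+

lemma walk_map: "walk (strip_edges T n) xs \<Longrightarrow> walk E (map h xs)"
  unfolding successively_map by (erule successively_mono) (use edges in fastforce)

text \<open>Vertex \<open>Suc c\<close> is adjacent to \<open>c\<close> and to
  \<open>pivot T c\<close>; as rung \<open>c\<close> is not contained in \<open>Z\<close>, one of
  them avoids \<open>Z\<close> and is reachable by induction.\<close>

lemma reach_lower:
  assumes "h 0 \<notin> Z" "m < n" "\<And>c. 0 < c \<Longrightarrow> c < m \<Longrightarrow> \<not> rung c \<subseteq> Z"
  shows "w \<le> m \<Longrightarrow> h w \<notin> Z \<Longrightarrow> h w \<in> reach E Z (h 0)"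
proof (induction w rule: less_induct)
  case (less w)
  show ?case
  proof (cases w)
    case 0
    then show ?thesis by (simp add: reach_refl)
  next
    case (Suc c)
    show ?thesis
    proof (cases "h c \<in> Z")
      case False
      then have "h c \<in> reach E Z (h 0)" using less Suc by simp
      then show ?thesis using reach_step edge_Suc[of c] less Suc assms by (metis le_less_trans)
    next
      case True
      then have "0 < c" using assms(1) by (cases c) auto
      then have "h (pivot T c) \<notin> Z" using assms(3)[of c] True less Suc by (auto simp: rung_def)
      moreover have "pivot T c < c" using \<open>0 < c\<close> by (rule pivot_less)
      ultimately have "h (pivot T c) \<in> reach E Z (h 0)" using less Suc by simp
      then show ?thesis using reach_step edge_pivot_Suc[of c] less Suc assms
        by (metis le_less_trans)
    qed
  qed
qed

lemma reach_upper:
  assumes "h i \<in> reach E Z u" "i \<le> j" "j < n" "\<And>c. i < c \<Longrightarrow> c \<le> j \<Longrightarrow> h c \<notin> Z"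
  shows "h j \<in> reach E Z u"
  using assms(2,3,4)
proof (induction j rule: dec_induct)
  case base
  show ?case by (rule assms(1))
next
  case (step j)
  then show ?case using reach_step[of "h j" E Z u "h (Suc j)"] edge_Suc[of j] by simp
qed

text \<open>A walk around the rung, taken shortest between the two sides, would together with both
  boundary paths and the rung be the configuration excluded by
  \<open>outerplanar_no_crossing_walks\<close>.\<close>

lemma rung_separates:
  assumes G: "simple_graph V E" "outerplanar V E" and k: "2 \<le> k" "Suc k < n"
  shows "h (n - 1) \<notin> reach E (rung k) (h 0)"
proof
  assume reach: "h (n - 1) \<in> reach E (rung k) (h 0)"
  have piv: "0 < pivot T k" "pivot T k < k" using k pivot_pos pivot_less by auto
  obtain xs where xs: "walk (strip_edges T n) xs" "distinct xs" "set xs = {..k}"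
    "hd xs = pivot T k" "last xs = k"
    using lower_boundary_walk[of k n T] k by auto
  obtain ys where ys: "walk (strip_edges T n) ys" "distinct ys"
    "set ys = insert (pivot T k) {k..<n}" "hd ys = pivot T k" "last ys = k"
    using upper_boundary_walk[of k n T] k by auto
  have ne: "xs \<noteq> []" "ys \<noteq> []" using xs ys by auto
  \<comment> \<open>The two sides of the strip without the rung; \<open>h 0\<close> is in
    \<open>?A\<close> because \<open>0 < pivot T k\<close>.\<close>
  let ?A = "h ` ({..k} - {pivot T k, k})" and ?B = "h ` {Suc k..<n}"
  have "h 0 \<notin> rung k" using in_rung[of 0 k] k piv by auto
  then obtain zs where zs: "walk E zs" "distinct zs" "zs \<noteq> []" "set zs \<inter> rung k = {}"
    "hd zs \<in> ?A" "last zs \<in> ?B" "set zs \<inter> ?A = {hd zs}" "set zs \<inter> ?B = {last zs}"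
    by (rule shortest_crossing_walk[OF reach, of ?A ?B]) (use k piv in auto)
  have rung: "rung k = {h (pivot T k), h k}" by (simp add: rung_def)
  have img_xs: "set (map h xs) = ?A \<union> rung k"
    using xs(3) piv by (auto simp: rung_def)
  have img_ys: "set (map h ys) = ?B \<union> rung k"
  proof -
    have "{k..<n} = insert k {Suc k..<n}" using k(2) by fastforce
    then show ?thesis by (simp add: ys(3) rung_def Un_commute)
  qed
  have sub: "set xs \<subseteq> {..<n}" "set ys \<subseteq> {..<n}" using k piv by (auto simp: xs(3) ys(3))
  show False
  proof (rule outerplanar_no_crossing_walks[OF G, of "map h xs" "h (pivot T k)" "h k" "hd zs" "map h ys" "last zs" zs])
    show "walk E (map h xs)" "walk E (map h ys)" using walk_map xs ys by auto
    show "distinct (map h xs)" "distinct (map h ys)"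
      using xs(2) ys(2) inj_on_subset[OF inj sub(1)] inj_on_subset[OF inj sub(2)]
      by (simp_all add: distinct_map)
    show "hd (map h xs) = h (pivot T k)" "last (map h xs) = h k"
      "hd (map h ys) = h (pivot T k)" "last (map h ys) = h k"
      using xs ys ne by (auto simp: hd_map last_map)
    show "hd zs \<in> set (map h xs) - {h (pivot T k), h k}"
      using zs(3-5) hd_in_set[OF zs(3)] unfolding img_xs rung by blast
    show "last zs \<in> set (map h ys) - {h (pivot T k), h k}"
      using zs(4,6) last_in_set[OF zs(3)] unfolding img_ys rung by blast
    show "{h (pivot T k), h k} \<in> E"
      using edges[OF strip_edge_pivot[of k n T]] k by simp
    have "set (map h xs) \<inter> set (map h ys) = h ` (set xs \<inter> set ys)"
      using inj_on_image_Int[OF inj sub] by simp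
    also have "set xs \<inter> set ys = {pivot T k, k}" using k piv by (auto simp: xs(3) ys(3))
    finally show "set (map h xs) \<inter> set (map h ys) = {h (pivot T k), h k}" by simp
    show "set zs \<inter> set (map h xs) = {hd zs}" "set zs \<inter> set (map h ys) = {last zs}"
      unfolding img_xs img_ys Int_Un_distrib zs(4,7,8) by simp_all
  qed (use zs in auto)
qed

text \<open>If \<open>Z\<close> contained no rung, \<open>reach_lower\<close> would lead from
  \<open>h 0\<close> to \<open>h (n - 1)\<close>. Equal cardinalities turn containment into
  equality.\<close>

lemma separator_is_rung:
  assumes "h (n - 1) \<notin> reach E Z (h 0)" "h 0 \<notin> Z" "h (n - 1) \<notin> Z" "card Z = 2" "0 < n"
  shows "\<exists>k. 2 \<le> k \<and> Suc k < n \<and> rung k = Z"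
proof -
  obtain k where k: "0 < k" "k < n - 1" "rung k \<subseteq> Z"
    using reach_lower[of Z "n - 1" "n - 1"] assms by auto
  have "finite Z" using assms(4) by (metis card.infinite zero_neq_numeral)
  then have "rung k = Z"
    using k card_rung[of k] assms(4) by (intro card_subset_eq) auto
  \<comment> \<open>Rung 1 is the image of \<open>{0, 1}\<close> for every \<open>T\<close>, and
    \<open>Z\<close> avoids \<open>h 0\<close>.\<close>
  moreover have "k \<noteq> 1"
  proof
    assume "k = 1"
    then have "h 0 \<in> rung k" by (simp add: rung_def pivot.simps(2))
    then show False using k(3) assms(2) by blast
  qed
  ultimately show ?thesis using k by (intro exI[of _ k]) auto
qed

text \<open>Walks from \<open>h 0\<close> that avoid rung \<open>k\<close> never touch rung
  \<open>Suc k\<close>, so they survive when the latter is removed instead. The end of rung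
  \<open>k\<close> that is not on rung \<open>Suc k\<close> becomes reachable in addition. Ordering
  rungs by these sets thus recovers their indices.\<close>

lemma reach_rung_strict:
  assumes G: "simple_graph V E" "outerplanar V E" and k: "2 \<le> k" "Suc (Suc k) < n"
  shows "reach E (rung k) (h 0) \<subset> reach E (rung (Suc k)) (h 0)"
proof -
  have piv: "0 < pivot T k" "pivot T k < k" "0 < pivot T (Suc k)" "pivot T (Suc k) < Suc k"
    using k pivot_pos[of k] pivot_pos[of "Suc k"] pivot_less[of k T] pivot_less[of "Suc k" T]
    by linarith+
  have u: "h 0 \<notin> rung k" "h 0 \<notin> rung (Suc k)"
    using in_rung[of 0 k] in_rung[of 0 "Suc k"] k piv by auto
  \<comment> \<open>From \<open>h (Suc k)\<close> the images of consecutive vertices lead to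
    \<open>h (n - 1)\<close> without meeting rung \<open>k\<close>.\<close>
  have next_nin: "h (Suc k) \<notin> reach E (rung k) (h 0)"
  proof
    assume "h (Suc k) \<in> reach E (rung k) (h 0)"
    then have "h (n - 1) \<in> reach E (rung k) (h 0)"
      using in_rung[of _ k] k piv by (elim reach_upper) auto
    then show False using rung_separates[OF G] k by simp
  qed
  have piv_in: "h (pivot T (Suc k)) \<in> rung k"
    using pivot_Suc_cases[of T k] by (auto simp: rung_def)
  have disj: "w \<notin> rung (Suc k)" if "w \<in> reach E (rung k) (h 0)" for w
    using that next_nin piv_in reach_avoids[OF that u(1)] by (auto simp: rung_def[of "Suc k"])
  have "w \<in> reach E (rung (Suc k)) (h 0)" if "w \<in> reach E (rung k) (h 0)" for w
    using that
  proof (induction rule: reach_induct)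
    case (step a b)
    then have "b \<in> reach E (rung k) (h 0)" by (blast intro: reach_step)
    then show ?case using step disj reach_step by metis
  qed (rule reach_refl)
  \<comment> \<open>\<open>d\<close> is the gained vertex: it belongs to rung \<open>k\<close> but
    is dropped from rung \<open>Suc k\<close>.\<close>
  moreover obtain d where d: "d \<in> {pivot T k, k}" "d \<noteq> pivot T (Suc k)"
    using piv by (metis insert_iff less_irrefl)
  then have "d \<le> Suc k" "h d \<notin> rung (Suc k)"
    using in_rung[of d "Suc k"] k piv by auto
  then have "h d \<in> reach E (rung (Suc k)) (h 0)"
  proof (intro reach_lower[of _ "Suc k"] u)
    fix c assume c: "0 < c" "c < Suc k"
    have "rung c \<noteq> rung (Suc k)"
      using in_rung[of "Suc k" c] in_rung[of "Suc k" "Suc k"] c k pivot_less[of c T] by auto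
    moreover have "finite (rung (Suc k))" by (simp add: rung_def)
    ultimately show "\<not> rung c \<subseteq> rung (Suc k)"
      using card_rung[of c] card_rung[of "Suc k"] c k card_subset_eq[of "rung (Suc k)" "rung c"]
      by auto
  qed (use k in auto)
  moreover have "h d \<notin> reach E (rung k) (h 0)"
    using d reach_avoids[OF _ u(1)] by (auto simp: rung_def)
  ultimately show ?thesis by blast
qed

text \<open>Consecutive rungs share a vertex; whether three in a row share one tells the turns apart.\<close>

lemma rung_decode:
  assumes "3 \<le> k" "Suc k < n"
  shows "Suc k \<in> T \<longleftrightarrow> rung (Suc k) \<inter> rung k \<inter> rung (k - 1) = {}"
proof -
  obtain j where j: "k = Suc j" using assms by (cases k) auto
  have less: "pivot T k < k" "pivot T j < j"
    using assms j pivot_less[of k T] pivot_less[of j T] by linarith+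
  let ?e = "\<lambda>i. {pivot T i, i}"
  have "rung (Suc k) \<inter> rung k \<inter> rung j = h ` (?e (Suc k) \<inter> ?e k \<inter> ?e j)"
    using inj_on_image_Int[OF inj, of "?e (Suc k) \<inter> ?e k" "?e j"]
      inj_on_image_Int[OF inj rung_sub[of "Suc k"] rung_sub[of k]] rung_sub[of "Suc k"] rung_sub[of j] assms j
    unfolding rung_def by auto
  moreover have "?e (Suc k) \<inter> ?e k \<inter> ?e j = {} \<longleftrightarrow> Suc k \<in> T"
  proof (cases "Suc k \<in> T")
    case True
    then have "?e (Suc k) = {k, Suc k}" by (simp add: pivot.simps(2))
    moreover have "k \<notin> ?e j" "Suc k \<notin> ?e k" using less j by auto
    ultimately show ?thesis using True less by auto
  next
    case False
    then have "pivot T k \<in> ?e (Suc k)" by (simp add: pivot.simps(2))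
    moreover have "pivot T k \<in> ?e j" using pivot_Suc_cases[of T j] j by auto
    ultimately show ?thesis using False by blast
  qed
  ultimately show ?thesis by (simp add: j)
qed

end

section \<open>Recovering a strip from the images of its ends\<close>

lemma strict_chain_less:
  fixes F :: "nat \<Rightarrow> 'c::order"
  assumes "\<And>k. a \<le> k \<Longrightarrow> k < b \<Longrightarrow> F k < F (Suc k)" "a \<le> i" "i < j" "j \<le> b"
  shows "F i < F j"
  using assms(3,4)
proof (induction j)
  case (Suc j)
  then have "F j < F (Suc j)" using assms(1)[of j] assms(2) by simp
  then show ?case using Suc by (cases "i = j") auto
qed simp

text \<open>A finite set has only one enumeration that is strictly increasing under
  \<open>r\<close>. The order may be partial, since the chains themselves supply all
  comparisons.\<close>

lemma strict_chains_equal: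
  fixes r :: "'b \<Rightarrow> 'c::order" and f g :: "nat \<Rightarrow> 'b"
  assumes img: "f ` {a..b} = g ` {a..b}"
    and f: "\<And>k. a \<le> k \<Longrightarrow> k < b \<Longrightarrow> r (f k) < r (f (Suc k))"
    and g: "\<And>k. a \<le> k \<Longrightarrow> k < b \<Longrightarrow> r (g k) < r (g (Suc k))"
  shows "a \<le> k \<Longrightarrow> k \<le> b \<Longrightarrow> f k = g k"
proof (induction k rule: less_induct)
  case (less k)
  note lf = strict_chain_less[of a b "\<lambda>k. r (f k)", OF f]
  note lg = strict_chain_less[of a b "\<lambda>k. r (g k)", OF g]
  have "f k \<in> g ` {a..b}" "g k \<in> f ` {a..b}"
    using less.prems unfolding img[symmetric] by (simp, simp add: img)
  then obtain i j where i: "a \<le> i" "i \<le> b" "f k = g i" and j: "a \<le> j" "j \<le> b" "g k = f j"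
    by auto
  \<comment> \<open>If \<open>i < k\<close>, the induction hypothesis gives
    \<open>f i = g i = f k\<close>, against strict growth.\<close>
  have "k \<le> i"
  proof (rule ccontr)
    assume "\<not> k \<le> i"
    then have "f i = f k" "r (f i) < r (f k)" using less i lf[of i k] by auto
    then show False by simp
  qed
  moreover have "k \<le> j"
  proof (rule ccontr)
    assume "\<not> k \<le> j"
    then have "g j = g k" "r (g j) < r (g k)" using less j lg[of j k] by auto
    then show False by simp
  qed
  \<comment> \<open>Otherwise \<open>r (g k) < r (g i) = r (f k)\<close> and, symmetrically,
    \<open>r (f k) < r (g k)\<close>.\<close>
  moreover have "\<not> (k < i \<and> k < j)"
  proof
    assume "k < i \<and> k < j"
    then have "r (g k) < r (f k)" "r (f k) < r (g k)"
      using lg[of k i] lf[of k j] i j less.prems by simp_all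
    then show False by simp
  qed
  ultimately have "i = k \<or> j = k" by linarith
  then show ?case using i j by auto
qed

text \<open>Being a separator of the two ends is a property of \<open>E\<close> alone: a rung of one
  strip separates the common ends, so \<open>separator_is_rung\<close> makes it a rung of the
  other.\<close>

lemma embedded_strips_rungs_subset:
  assumes G: "simple_graph V E" "outerplanar V E"
    and h: "embedded_strip E n T h" and h': "embedded_strip E n T' h'"
    and ends: "h 0 = h' 0" "h (n - 1) = h' (n - 1)"
  shows "embedded_strip.rung T h ` {2..n - 2} \<subseteq> embedded_strip.rung T' h' ` {2..n - 2}"
proof
  interpret h: embedded_strip E n T h by fact
  interpret h': embedded_strip E n T' h' by fact
  fix Z assume "Z \<in> h.rung ` {2..n - 2}"
  then obtain k where k: "2 \<le> k" "Suc k < n" "Z = h.rung k" by auto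
  have "\<exists>j. 2 \<le> j \<and> Suc j < n \<and> h'.rung j = Z"
  proof (rule h'.separator_is_rung)
    show "h' (n - 1) \<notin> reach E Z (h' 0)"
      using h.rung_separates[OF G k(1,2)] ends k(3) by simp
    show "h' 0 \<notin> Z" "h' (n - 1) \<notin> Z"
      using h.in_rung[of 0 k] h.in_rung[of "n - 1" k] h.pivot_pos[of k] pivot_less[of k T] k ends
      by auto
    show "card Z = 2" "0 < n" using h.card_rung[of k] k by auto
  qed
  then show "Z \<in> h'.rung ` {2..n - 2}" by force
qed

lemma embedded_strips_equal:
  assumes G: "simple_graph V E" "outerplanar V E"
    and h: "embedded_strip E n T h" and h': "embedded_strip E n T' h'"
    and ends: "h 0 = h' 0" "h (n - 1) = h' (n - 1)"
    and k: "4 \<le> k" "Suc k < n"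
  shows "k \<in> T \<longleftrightarrow> k \<in> T'"
proof -
  interpret h: embedded_strip E n T h by fact
  interpret h': embedded_strip E n T' h' by fact
  have img: "h.rung ` {2..n - 2} = h'.rung ` {2..n - 2}"
    using embedded_strips_rungs_subset[OF G h h'] embedded_strips_rungs_subset[OF G h' h] ends
    by auto
  have eq: "h.rung j = h'.rung j" if "2 \<le> j" "j \<le> n - 2" for j
    using img _ _ that
  proof (rule strict_chains_equal[where r = "\<lambda>Z. reach E Z (h 0)"])
    fix i assume "2 \<le> i" "i < n - 2"
    then show "reach E (h.rung i) (h 0) < reach E (h.rung (Suc i)) (h 0)"
      "reach E (h'.rung i) (h 0) < reach E (h'.rung (Suc i)) (h 0)"
      using h.reach_rung_strict[OF G, of i] h'.reach_rung_strict[OF G, of i] ends by auto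
  qed
  \<comment> \<open>Decoding turn \<open>k\<close> uses rungs \<open>k\<close>, \<open>k - 1\<close>
    and \<open>k - 2\<close>; the bounds \<open>4 \<le> k\<close> and \<open>Suc k < n\<close> put
    all three indices in \<open>{2..n - 2}\<close>.\<close>
  obtain j where j: "k = Suc j" using k by (cases k) auto
  have "h.rung (Suc j) = h'.rung (Suc j)" "h.rung j = h'.rung j"
    "h.rung (j - 1) = h'.rung (j - 1)"
    using k j by (auto intro!: eq)
  then show ?thesis
    using h.rung_decode[of j] h'.rung_decode[of j] k j by simp
qed

theorem theorem11:
  fixes n :: nat and V :: "'a set" and E :: "'a set set"
  assumes "n > 0"
    and "simple_graph V E" and "outerplanar V E"
    and "\<And>(W :: nat set) (F :: nat set set).
           simple_graph W F \<Longrightarrow> outerplanar W F \<Longrightarrow> card W = n \<Longrightarrow>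
           contained_as_subgraph W F V E"
  shows "real (card V) \<ge> sqrt 2 powr (real n - 5)"
proof -
  \<comment> \<open>Inserting \<open>2\<close> into every turn set meets the assumption
    \<open>two\<close> of \<open>embedded_strip\<close>.\<close>
  have "contained_as_subgraph {..<n} (strip_edges (insert 2 S) n) V E" for S
    using simple_graph_strip outerplanar_strip by (intro assms(4)) auto
  then have "\<forall>S. \<exists>h. inj_on h {..<n} \<and> h ` {..<n} \<subseteq> V \<and> (\<forall>e\<in>strip_edges (insert 2 S) n. h ` e \<in> E)"
    unfolding contained_as_subgraph_def by blast
  then obtain h where h: "\<And>S. inj_on (h S) {..<n}" "\<And>S. h S ` {..<n} \<subseteq> V"
    "\<And>S e. e \<in> strip_edges (insert 2 S) n \<Longrightarrow> h S ` e \<in> E"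
    by metis
  have strip: "embedded_strip E n (insert 2 S) (h S)" for S
    using h by unfold_locales auto
  have "finite V" using assms(2) by (simp add: simple_graph_def)
  have in_V: "h S i \<in> V" if "i < n" for S i using h(2)[of S] that by blast
  have N: "1 \<le> card V"
    using in_V[of 0 "{}"] assms(1) \<open>finite V\<close> by (auto simp: Suc_le_eq card_gt_0_iff)
  show ?thesis
  proof (cases "n < 5")
    case True
    \<comment> \<open>The exponent is negative, so the bound is at most 1, and \<open>V\<close> is
      nonempty because \<open>n > 0\<close>.\<close>
    then have "sqrt 2 powr (real n - 5) \<le> sqrt 2 powr 0" by (intro powr_mono) auto
    then show ?thesis using N by simp
  next
    case False
    \<comment> \<open>Turn 3 is fixed because it only swaps the vertices 1 and 2; the turn at \<open>n - 1\<close> yields no edge.\<close>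
    let ?P = "Pow {4..n - 2}" and ?ends = "\<lambda>S. (h S 0, h S (n - 1))"
    have "inj_on ?ends ?P"
    proof (rule inj_onI)
      fix S S' assume S: "S \<in> ?P" "S' \<in> ?P" and eq: "?ends S = ?ends S'"
      have "k \<in> S \<longleftrightarrow> k \<in> S'" if "k \<in> {4..n - 2}" for k
        using embedded_strips_equal[OF assms(2,3) strip[of S] strip[of S'], of k] eq that False
        by auto
      then show "S = S'" using S by blast
    qed
    moreover have "?ends ` ?P \<subseteq> V \<times> V" using in_V assms(1) by auto
    ultimately have "card ?P \<le> card (V \<times> V)"
      using \<open>finite V\<close> by (intro card_inj_on_le) auto
    \<comment> \<open>The interval \<open>{4..n - 2}\<close> of free turns has \<open>n - 5\<close>
      elements.\<close>
    then have "2 ^ (n - 5) \<le> card V * card V"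
      using False by (simp add: card_Pow card_cartesian_product)
    then have "real (2 ^ (n - 5)) \<le> real (card V * card V)"
      by (simp only: of_nat_le_iff)
    then have "2 ^ (n - 5) \<le> (real (card V))\<^sup>2" by (simp add: power2_eq_square)
    moreover have "(sqrt 2 powr (real n - 5))\<^sup>2 = 2 ^ (n - 5)"
    proof -
      have "sqrt 2 powr (real n - 5) = sqrt 2 ^ (n - 5)"
        using False by (subst powr_realpow[symmetric]) (auto simp: of_nat_diff)
      then show ?thesis
        by (simp add: power_mult[symmetric] mult.commute[of _ 2]) (simp add: power_mult)
    qed
    ultimately have "(sqrt 2 powr (real n - 5))\<^sup>2 \<le> (real (card V))\<^sup>2" by simp
    then show ?thesis by (rule power2_le_imp_le) simp
  qed
qed

end
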